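(* Let $\mathcal{M}=\mathcal{SE}_2(3)\times\mathbb{R}^9$ with elements $\xi=(\mathbf{T},\boldsymbol{b})$, $\mathbb{L}=\mathbb{R}^{18}$ with elements $u=(\boldsymbol{w},\boldsymbol{\tau})$, $\boldsymbol{w},\boldsymbol{\tau}\in\mathbb{R}^9$, and consider the biased inertial navigation system $\dot\xi=f(\xi,u)=f_u(\xi)$ given by $$\dot{\mathbf{T}}=\mathbf{T}(\mathbf{W}-\mathbf{B}+\mathbf{N})+(\mathbf{G}-\mathbf{N})\mathbf{T},\qquad \dot{\boldsymbol{b}}=\boldsymbol{\tau},$$ where $\mathbf{W}=\boldsymbol{w}^{\wedge}$ and $\mathbf{B}=\boldsymbol{b}^{\wedge}$. Let $\mathbf{G_{TG}}=\mathbf{SE}_2(3)\ltimes\mathfrak{se}_2(3)$ with Lie algebra $\mathfrak{g}_{\mathbf{TG}}$. Define $\Lambda:\mathcal{M}\times\mathbb{L}\to\mathfrak{g}_{\mathbf{TG}}$ by $\Lambda(\xi,u):=(\Lambda_1(\xi,u),\Lambda_2(\xi,u))$, where $\Lambda_1,\Lambda_2:\mathcal{M}\times\mathbb{L}\to\mathfrak{se}_2(3)$ are $$\Lambda_1(\xi,u):=(\mathbf{W}-\mathbf{B}+\mathbf{N})+\mathbf{T}^{-1}(\mathbf{G}-\mathbf{N})\mathbf{T},\qquad \Lambda_2(\xi,u):=\mathrm{ad}_{\boldsymbol{b}^{\wedge}}[\Lambda_1(\xi,u)]-\boldsymbol{\tau}^{\wedge}.$$ Then $\Lambda$ is an equivariant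 lift for the system with respect to the symmetry group $\mathbf{G_{TG}}$ (with its actions $\phi(X,\xi)=(\mathbf{T}D,\mathbf{Ad}^{\vee}_{D^{-1}}(\boldsymbol{b}-\delta^{\vee}))$ on $\mathcal{M}$ and $\psi(X,u)=(\mathbf{Ad}^{\vee}_{D^{-1}}(\boldsymbol{w}-\delta^{\vee})+\Omega(D^{-1})^{\vee},\mathbf{Ad}^{\vee}_{D^{-1}}\boldsymbol{\tau})$ on $\mathbb{L}$, for $X=(D,\delta)$).
   Context: $\mathbf{SE}_2(3)$ is the matrix Lie group of $5\times5$ matrices $\begin{bmatrix}A&\boldsymbol{a}&\boldsymbol{b}\\0&1&0\\0&0&1\end{bmatrix}$ with $A\in\mathbf{SO}(3)$, $\boldsymbol{a},\boldsymbol{b}\in\mathbb{R}^3$; $\mathcal{SE}_2(3)$ is its underlying smooth manifold. Its Lie algebra $\mathfrak{se}_2(3)$ consists of the matrices $(\boldsymbol{\omega},\boldsymbol{v},\boldsymbol{p})^{\wedge}=\begin{bmatrix}\boldsymbol{\omega}^{\wedge}&\boldsymbol{v}&\boldsymbol{p}\\0&0&0\\0&0&0\end{bmatrix}$, where $\boldsymbol{\omega}^{\wedge}$ is the $3\times3$ skew-symmetric cross-product matrix; $(\cdot)^{\vee}$ is the inverse of $(\cdot)^{\wedge}$. $\mathrm{Ad}_D[\eta]=D\eta D^{-1}$, $\mathrm{ad}_\eta[\kappa]=[\eta,\kappa]=\eta\kappa-\kappa\eta$, and $\mathbf{Ad}^{\vee}_D\boldsymbol{u}=(\mathrm{Ad}_D[\boldsymbol{u}^{\wedge}])^{\vee}$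 for $\boldsymbol{u}\in\mathbb{R}^9$. $\mathbf{N}\in\mathbb{R}^{5\times5}$ has a single nonzero entry, equal to $1$, in row $4$, column $5$. $\mathbf{G}\in\mathbb{R}^{5\times5}$ has the fixed gravity vector $\boldsymbol{g}\in\mathbb{R}^3$ in rows $1$–$3$ of column $4$ and zeros elsewhere. $\Omega(Z)=Z\mathbf{N}-\mathbf{N}Z=Z\mathbf{N}-\mathbf{N}\in\mathfrak{se}_2(3)$ for $Z\in\mathbf{SE}_2(3)$. The group product in $\mathbf{G_{TG}}$ is $XY=(D_XD_Y,\;\delta_X+\mathrm{Ad}_{D_X}[\delta_Y])$, with inverse $X^{-1}=(D^{-1},-\mathrm{Ad}_{D^{-1}}[\delta])$. Its Lie algebra is identified with $\mathfrak{se}_2(3)\oplus\mathfrak{se}_2(3)$, and for $X=(D,\delta)$ its adjoint map is $\mathrm{Ad}_X[(\gamma,\zeta)]=(\mathrm{Ad}_D[\gamma],\;\mathrm{Ad}_D[\zeta]+\mathrm{ad}_{\delta}[\mathrm{Ad}_D[\gamma]])$. A map $\Lambda$ into the Lie algebra is a lift if $\mathrm{d}\phi_\xi[\Lambda(\xi,u)]:=\mathrm{D}_X|_I\phi_\xi(X)[\Lambda(\xi,u)]=f(\xi,u)$ for all $\xi,u$, where $\phi_\xi(X)=\phi(X,\xi)$. It is an equivariant lift if in addition $\mathrm{Ad}_{X^{-1}}[\Lambda(\xi,u)]=\Lambda(\phi(X,\xi),\psi(X,u))$ for all $X,\xi,u$. *)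

theory Defs
  imports "HOL-Analysis.Analysis" "HOL-Algebra.Group"
begin

unbundle no cross3_syntax
unbundle set_product_syntax

type_synonym mat5 = "real^5^5"
type_synonym vec9 = "real^9"

section \<open>The group \<open>SE\<^sub>2(3)\<close> and its Lie algebra\<close>

text \<open>
  In the index types \<open>3\<close>, \<open>5\<close> and \<open>9\<close> the largest index is written as the numeral itself
  (which equals \<open>0\<close> in that type), as in the library's \<open>vector_3\<close>.
  \<open>block A a b s\<close> is the 5-by-5 matrix with rows \<open>(A, a, b)\<close>, \<open>(0, s, 0)\<close>, \<open>(0, 0, s)\<close>.
\<close>

definition block :: "real^3^3 \<Rightarrow> real^3 \<Rightarrow> real^3 \<Rightarrow> real \<Rightarrow> mat5" where
  "block A a b s = vector
     [vector [A$1$1, A$1$2, A$1$3, a$1, b$1],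
      vector [A$2$1, A$2$2, A$2$3, a$2, b$2],
      vector [A$3$1, A$3$2, A$3$3, a$3, b$3],
      vector [0, 0, 0, s, 0],
      vector [0, 0, 0, 0, s]]"

definition SE23 :: "mat5 set" where
  "SE23 = {block A a b 1 | A a b. rotation_matrix A}"

definition skew :: "real^3 \<Rightarrow> real^3^3" where
  "skew \<omega> = matrix (cross3 \<omega>)"

text \<open>A vector of \<open>\<real>\<^sup>9\<close> is read as the stacked triple \<open>(\<omega>, v, p)\<close>.\<close>

definition wedge :: "vec9 \<Rightarrow> mat5" where
  "wedge u = block (skew (vector [u$1, u$2, u$3])) (vector [u$4, u$5, u$6])
                   (vector [u$7, u$8, u$9]) 0"

definition se23 :: "mat5 set" where
  "se23 = range wedge"

definition vee :: "mat5 \<Rightarrow> vec9" where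
  "vee = inv_into UNIV wedge"

definition Ad :: "mat5 \<Rightarrow> mat5 \<Rightarrow> mat5" where
  "Ad D \<eta> = D ** \<eta> ** matrix_inv D"

definition ad :: "mat5 \<Rightarrow> mat5 \<Rightarrow> mat5" where
  "ad \<eta> \<kappa> = \<eta> ** \<kappa> - \<kappa> ** \<eta>"

definition Ad_vee :: "mat5 \<Rightarrow> vec9 \<Rightarrow> vec9" where
  "Ad_vee D u = vee (Ad D (wedge u))"

definition Nmat :: "mat5" where
  "Nmat = (\<chi> i j. if i = 4 \<and> j = 5 then 1 else 0)"

definition Gmat :: "real^3 \<Rightarrow> mat5" where
  "Gmat g = block 0 g 0 0"

definition Omega :: "mat5 \<Rightarrow> mat5" where
  "Omega Z = Z ** Nmat - Nmat ** Z"

section \<open>The tangent group\<close>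

definition TG :: "(mat5 \<times> mat5) monoid" where
  "TG = \<lparr>carrier = SE23 \<times> se23,
         mult = (\<lambda>X Y. (fst X ** fst Y, snd X + Ad (fst X) (snd Y))),
         one = (mat 1, 0)\<rparr>"

definition TG_alg :: "(mat5 \<times> mat5) set" where
  "TG_alg = se23 \<times> se23"

definition TG_Ad :: "mat5 \<times> mat5 \<Rightarrow> mat5 \<times> mat5 \<Rightarrow> mat5 \<times> mat5" where
  "TG_Ad = (\<lambda>(D, \<delta>) (\<gamma>, \<zeta>). (Ad D \<gamma>, Ad D \<zeta> + ad \<delta> (Ad D \<gamma>)))"

section \<open>Lifts\<close>

text \<open>
  \<open>differential_eq S F x v w\<close> says that \<open>F\<close>, as a function on the embedded submanifold \<open>S\<close>, is
  differentiable at \<open>x\<close> and its differential maps the tangent vector \<open>v\<close> to \<open>w\<close>.  A Frechet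
  derivative within \<open>S\<close> is only determined on the tangent space of \<open>S\<close> at \<open>x\<close>; the second conjunct
  makes the value independent of its choice.
\<close>

definition differential_eq ::
    "'a::real_normed_vector set \<Rightarrow> ('a \<Rightarrow> 'b::real_normed_vector) \<Rightarrow> 'a \<Rightarrow> 'a \<Rightarrow> 'b \<Rightarrow> bool" where
  "differential_eq S F x v w \<longleftrightarrow>
     (\<exists>F'. (F has_derivative F') (at x within S)) \<and>
     (\<forall>F'. (F has_derivative F') (at x within S) \<longrightarrow> F' v = w)"

text \<open>
  Arguments: group \<open>G\<close> embedded in a normed space, its Lie algebra \<open>\<gg>\<close>, state space \<open>M\<close>, right
  action \<open>\<phi>\<close>, system \<open>f\<close> and candidate lift \<open>\<Lambda>\<close>; the input space is the whole type \<open>'l\<close>.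
\<close>

definition is_lift ::
    "('g::real_normed_vector, 'z) monoid_scheme \<Rightarrow> 'g set \<Rightarrow> 'm::real_normed_vector set \<Rightarrow>
     ('g \<Rightarrow> 'm \<Rightarrow> 'm) \<Rightarrow> ('m \<Rightarrow> 'l \<Rightarrow> 'm) \<Rightarrow> ('m \<Rightarrow> 'l \<Rightarrow> 'g) \<Rightarrow> bool" where
  "is_lift G \<gg> M \<phi> f \<Lambda> \<longleftrightarrow>
     (\<forall>\<xi>\<in>M. \<forall>u. \<Lambda> \<xi> u \<in> \<gg> \<and>
        differential_eq (carrier G) (\<lambda>X. \<phi> X \<xi>) \<one>\<^bsub>G\<^esub> (\<Lambda> \<xi> u) (f \<xi> u))"

definition is_equivariant_lift ::
    "('g::real_normed_vector, 'z) monoid_scheme \<Rightarrow> 'g set \<Rightarrow> ('g \<Rightarrow> 'g \<Rightarrow> 'g) \<Rightarrow>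
     'm::real_normed_vector set \<Rightarrow> ('g \<Rightarrow> 'm \<Rightarrow> 'm) \<Rightarrow> ('g \<Rightarrow> 'l \<Rightarrow> 'l) \<Rightarrow>
     ('m \<Rightarrow> 'l \<Rightarrow> 'm) \<Rightarrow> ('m \<Rightarrow> 'l \<Rightarrow> 'g) \<Rightarrow> bool" where
  "is_equivariant_lift G \<gg> AdG M \<phi> \<psi> f \<Lambda> \<longleftrightarrow>
     is_lift G \<gg> M \<phi> f \<Lambda> \<and>
     (\<forall>X\<in>carrier G. \<forall>\<xi>\<in>M. \<forall>u. AdG (inv\<^bsub>G\<^esub> X) (\<Lambda> \<xi> u) = \<Lambda> (\<phi> X \<xi>) (\<psi> X u))"

section \<open>The biased inertial navigation system\<close>

definition state_space :: "(mat5 \<times> vec9) set" where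
  "state_space = SE23 \<times> UNIV"

definition ins :: "real^3 \<Rightarrow> mat5 \<times> vec9 \<Rightarrow> vec9 \<times> vec9 \<Rightarrow> mat5 \<times> vec9" where
  "ins g = (\<lambda>(T, b) (w, \<tau>). (T ** (wedge w - wedge b + Nmat) + (Gmat g - Nmat) ** T, \<tau>))"

definition phi :: "mat5 \<times> mat5 \<Rightarrow> mat5 \<times> vec9 \<Rightarrow> mat5 \<times> vec9" where
  "phi = (\<lambda>(D, \<delta>) (T, b). (T ** D, Ad_vee (matrix_inv D) (b - vee \<delta>)))"

definition psi :: "mat5 \<times> mat5 \<Rightarrow> vec9 \<times> vec9 \<Rightarrow> vec9 \<times> vec9" where
  "psi = (\<lambda>(D, \<delta>) (w, \<tau>).
     (Ad_vee (matrix_inv D) (w - vee \<delta>) + vee (Omega (matrix_inv D)),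
      Ad_vee (matrix_inv D) \<tau>))"

definition Lambda1 :: "real^3 \<Rightarrow> mat5 \<times> vec9 \<Rightarrow> vec9 \<times> vec9 \<Rightarrow> mat5" where
  "Lambda1 g = (\<lambda>(T, b) (w, \<tau>).
     (wedge w - wedge b + Nmat) + matrix_inv T ** (Gmat g - Nmat) ** T)"

definition Lambda2 :: "real^3 \<Rightarrow> mat5 \<times> vec9 \<Rightarrow> vec9 \<times> vec9 \<Rightarrow> mat5" where
  "Lambda2 g = (\<lambda>(T, b) (w, \<tau>). ad (wedge b) (Lambda1 g (T, b) (w, \<tau>)) - wedge \<tau>)"

definition Lambda :: "real^3 \<Rightarrow> mat5 \<times> vec9 \<Rightarrow> vec9 \<times> vec9 \<Rightarrow> mat5 \<times> mat5" where
  "Lambda g \<xi> u = (Lambda1 g \<xi> u, Lambda2 g \<xi> u)"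

section \<open>Basic facts\<close>

lemma exhaust_5: fixes x :: 5 shows "x = 1 \<or> x = 2 \<or> x = 3 \<or> x = 4 \<or> x = 5"
proof (induct x)
  case (of_int z)
  then have "0 \<le> z" "z < 5" by simp_all
  then have "z = 0 \<or> z = 1 \<or> z = 2 \<or> z = 3 \<or> z = 4" by arith
  then show ?case by auto
qed

lemma exhaust_9: fixes x :: 9
  shows "x = 1 \<or> x = 2 \<or> x = 3 \<or> x = 4 \<or> x = 5 \<or> x = 6 \<or> x = 7 \<or> x = 8 \<or> x = 9"
proof (induct x)
  case (of_int z)
  then have "0 \<le> z" "z < 9" by simp_all
  then have "z = 0 \<or> z = 1 \<or> z = 2 \<or> z = 3 \<or> z = 4 \<or> z = 5 \<or> z = 6 \<or> z = 7 \<or> z = 8" by arith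
  then show ?case by auto
qed

lemma forall_5: "(\<forall>i::5. P i) \<longleftrightarrow> P 1 \<and> P 2 \<and> P 3 \<and> P 4 \<and> P 5"
  by (metis exhaust_5)

lemma forall_9: "(\<forall>i::9. P i) \<longleftrightarrow>
    P 1 \<and> P 2 \<and> P 3 \<and> P 4 \<and> P 5 \<and> P 6 \<and> P 7 \<and> P 8 \<and> P 9"
  by (metis exhaust_9)

lemma UNIV_5: "UNIV = {1, 2, 3, 4, 5::5}"
  using exhaust_5 by auto

lemma sum_5: "sum f (UNIV :: 5 set) = f 1 + f 2 + f 3 + f 4 + f 5"
  unfolding UNIV_5 by (simp add: ac_simps)

lemma vector_5 [simp]:
  "(vector [a,b,c,d,e] :: 'a::zero^5)$1 = a"
  "(vector [a,b,c,d,e] :: 'a^5)$2 = b"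
  "(vector [a,b,c,d,e] :: 'a^5)$3 = c"
  "(vector [a,b,c,d,e] :: 'a^5)$4 = d"
  "(vector [a,b,c,d,e] :: 'a^5)$5 = e"
  by (simp_all add: vector_def)

lemmas mat5_simps = vec_eq_iff forall_5 forall_3 sum_5 sum_3 matrix_matrix_mult_def
  matrix_vector_mult_def block_def

lemma block_mult:
  "block A a b s ** block A' a' b' s' =
   block (A ** A') (A *v a' + s' *\<^sub>R a) (A *v b' + s' *\<^sub>R b) (s * s')"
  by (simp add: mat5_simps mult.commute)

lemma block_add: "block A a b s + block A' a' b' s' = block (A + A') (a + a') (b + b') (s + s')"
  and block_uminus: "- block A a b s = block (- A) (- a) (- b) (- s)"
  by (simp_all add: mat5_simps)

lemma block_one: "block (mat 1) 0 0 1 = mat 1"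
  by (simp add: mat5_simps mat_def)

lemma skew_entries:
  "skew \<omega> = vector [vector [0, - \<omega>$3, \<omega>$2], vector [\<omega>$3, 0, - \<omega>$1], vector [- \<omega>$2, \<omega>$1, 0]]"
  by (simp add: skew_def matrix_def cross3_def vec_eq_iff forall_3 axis_def)

lemma wedge_inj: "inj wedge"
  by (rule injI) (simp add: wedge_def skew_entries mat5_simps forall_9)

lemma vee_wedge [simp]: "vee (wedge u) = u"
  by (simp add: vee_def wedge_inj)

lemma wedge_vee: "\<eta> \<in> se23 \<Longrightarrow> wedge (vee \<eta>) = \<eta>"
  by (simp add: vee_def se23_def f_inv_into_f)

lemma linear_wedge: "linear wedge"
  by (rule linearI) (simp_all add: wedge_def skew_entries mat5_simps algebra_simps)

lemma se23_eq: "se23 = {block (skew \<omega>) v p 0 | \<omega> v p. True}"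
proof -
  have "block (skew \<omega>) v p 0 \<in> range wedge" for \<omega> v p
  proof
    let ?u = "(\<chi> i. if i = 1 then \<omega>$1 else if i = 2 then \<omega>$2 else if i = 3 then \<omega>$3
                else if i = 4 then v$1 else if i = 5 then v$2 else if i = 6 then v$3
                else if i = 7 then p$1 else if i = 8 then p$2 else p$3) :: vec9"
    show "block (skew \<omega>) v p 0 = wedge ?u"
      by (simp add: wedge_def skew_entries mat5_simps)
  qed simp
  then show ?thesis unfolding se23_def wedge_def by auto
qed

lemma subspace_se23: "subspace se23"
  unfolding se23_def by (simp add: linear_subspace_image linear_wedge)

lemma rotation_transpose:
  assumes "rotation_matrix A"
  shows "A ** transpose A = mat 1" "transpose A ** A = mat 1" "rotation_matrix (transpose A)"
  using assms by (auto simp: rotation_matrix_def orthogonal_matrix_def)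

lemma SE23_inverse:
  fixes a b :: "real^3"
  assumes "rotation_matrix A"
  defines "B \<equiv> block (transpose A) (- (transpose A *v a)) (- (transpose A *v b)) 1"
  shows "block A a b 1 ** B = mat 1" "B ** block A a b 1 = mat 1" "B \<in> SE23"
proof -
  have neg: "C *v (- x) = - (C *v x)" for C :: "real^3^3" and x
    by (simp add: vec_eq_iff matrix_vector_mult_def sum_negf)
  note r = rotation_transpose[OF assms(1)]
  show "block A a b 1 ** B = mat 1"
    by (simp add: B_def block_mult r block_one neg matrix_vector_mul_assoc
        del: transpose_matrix_vector)
  show "B ** block A a b 1 = mat 1"
    by (simp add: B_def block_mult r block_one)
  show "B \<in> SE23" using r by (auto simp: B_def SE23_def)
qed

lemma matrix_inv_eq:
  fixes A B :: "real^'n^'n"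
  assumes "A ** B = mat 1"
  shows "matrix_inv A = B"
proof -
  have "B ** A = mat 1" using assms matrix_left_right_inverse by blast
  then have "A ** matrix_inv A = mat 1" unfolding matrix_inv_def using assms
    by (metis (mono_tags, lifting) someI_ex)
  then have "B ** (A ** matrix_inv A) = B" by simp
  then show ?thesis by (simp add: matrix_mul_assoc \<open>B ** A = mat 1\<close>)
qed

lemma SE23_inv_block:
  "rotation_matrix A \<Longrightarrow> matrix_inv (block A a b 1) =
     block (transpose A) (- (transpose A *v a)) (- (transpose A *v b)) 1"
  by (rule matrix_inv_eq, rule SE23_inverse)

lemma SE23_inv:
  assumes "D \<in> SE23"
  shows "matrix_inv D \<in> SE23" "D ** matrix_inv D = mat 1" "matrix_inv D ** D = mat 1"
    "matrix_inv (matrix_inv D) = D"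
proof -
  obtain A a b where D: "D = block A a b 1" "rotation_matrix A"
    using assms unfolding SE23_def by blast
  show "matrix_inv D \<in> SE23" "D ** matrix_inv D = mat 1" and *: "matrix_inv D ** D = mat 1"
    unfolding D(1) SE23_inv_block[OF D(2)] by (rule SE23_inverse[OF D(2)])+
  show "matrix_inv (matrix_inv D) = D" by (rule matrix_inv_eq[OF *])
qed

lemma SE23_one: "mat 1 \<in> SE23"
proof -
  have "rotation_matrix (mat 1 :: real^3^3)" by (simp add: rotation_matrix_def orthogonal_matrix_id)
  then have "block (mat 1) 0 0 1 \<in> SE23" unfolding SE23_def by blast
  then show ?thesis by (simp only: block_one)
qed

lemma SE23_mult:
  assumes "D \<in> SE23" "E \<in> SE23"
  shows "D ** E \<in> SE23"
proof -
  obtain A a b where D: "D = block A a b 1" "rotation_matrix A" using assms(1) by (auto simp: SE23_def)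
  obtain C c d where E: "E = block C c d 1" "rotation_matrix C" using assms(2) by (auto simp: SE23_def)
  have "D ** E = block (A ** C) (A *v c + a) (A *v d + b) 1" by (simp add: D(1) E(1) block_mult)
  moreover have "rotation_matrix (A ** C)"
    using D(2) E(2) by (simp add: rotation_matrix_def orthogonal_matrix_mul det_mul)
  ultimately show ?thesis unfolding SE23_def by blast
qed

lemma matrix_inv_mult:
  assumes "D \<in> SE23" "E \<in> SE23"
  shows "matrix_inv (D ** E) = matrix_inv E ** matrix_inv D"
proof (rule matrix_inv_eq)
  have "(D ** E) ** (matrix_inv E ** matrix_inv D) = D ** (E ** matrix_inv E) ** matrix_inv D"
    by (simp only: matrix_mul_assoc)
  then show "(D ** E) ** (matrix_inv E ** matrix_inv D) = mat 1"
    using assms by (simp add: SE23_inv)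
qed

lemma Ad_mult:
  "D \<in> SE23 \<Longrightarrow> E \<in> SE23 \<Longrightarrow> Ad (D ** E) \<eta> = Ad D (Ad E \<eta>)"
  by (simp add: Ad_def matrix_inv_mult matrix_mul_assoc)

lemma matrix_inv_one: "matrix_inv (mat 1 :: mat5) = mat 1"
  by (rule matrix_inv_eq) simp

lemma Ad_one: "Ad (mat 1) \<eta> = \<eta>"
  by (simp add: Ad_def matrix_inv_one)

lemma Ad_Ad_inv:
  assumes "D \<in> SE23"
  shows "Ad D (Ad (matrix_inv D) \<eta>) = \<eta>" "Ad (matrix_inv D) (Ad D \<eta>) = \<eta>"
  using assms by (simp_all add: Ad_mult[symmetric] SE23_inv Ad_one)

lemma linear_Ad: "linear (Ad D)"
proof (rule linearI)
  show "Ad D (x + y) = Ad D x + Ad D y" for x y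
    by (simp add: Ad_def matrix_add_ldistrib)
      (simp add: matrix_matrix_mult_def vec_eq_iff sum.distrib distrib_right)
  have "P ** (c *\<^sub>R Q) = c *\<^sub>R (P ** Q)" "(c *\<^sub>R P) ** Q = c *\<^sub>R (P ** Q)"
    for P Q :: mat5 and c
    by (simp_all add: matrix_matrix_mult_def vec_eq_iff sum_distrib_left mult_ac)
  then show "Ad D (c *\<^sub>R x) = c *\<^sub>R Ad D x" for c x
    by (simp add: Ad_def)
qed

lemmas Ad_linear = linear_add[OF linear_Ad] linear_diff[OF linear_Ad] linear_neg[OF linear_Ad]
  linear_0[OF linear_Ad]

lemma skew_conj:
  assumes "rotation_matrix A"
  shows "A ** skew \<omega> ** transpose A = skew (A *v \<omega>)"
proof -
  have "(A ** skew \<omega> ** transpose A) *v x = skew (A *v \<omega>) *v x" for x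
  proof -
    have s: "skew w *v y = cross3 w y" for w y
      by (simp add: skew_entries cross3_def vec_eq_iff forall_3 sum_3 matrix_vector_mult_def)
    have "(A ** skew \<omega> ** transpose A) *v x = A *v cross3 \<omega> (transpose A *v x)"
      by (simp add: s flip: matrix_vector_mul_assoc)
    also have "\<dots> = cross3 (A *v \<omega>) (A *v (transpose A *v x))"
      using cross_rotation_matrix[OF assms] by simp
    also have "\<dots> = skew (A *v \<omega>) *v x"
      by (simp only: s matrix_vector_mul_assoc rotation_transpose[OF assms] matrix_vector_mul_lid)
    finally show ?thesis .
  qed
  then show ?thesis by (simp add: matrix_eq)
qed

lemma Ad_se23:
  assumes "D \<in> SE23" "\<eta> \<in> se23"
  shows "Ad D \<eta> \<in> se23"
proof -
  obtain A a b where D: "D = block A a b 1" "rotation_matrix A" using assms by (auto simp: SE23_def)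
  obtain \<omega> v p where \<eta>: "\<eta> = block (skew \<omega>) v p 0" using assms by (auto simp: se23_eq)
  have inv: "matrix_inv D = block (transpose A) (- (transpose A *v a)) (- (transpose A *v b)) 1"
    unfolding D(1) by (rule SE23_inv_block[OF D(2)])
  have "\<exists>v' p'. Ad D \<eta> = block (A ** skew \<omega> ** transpose A) v' p' 0"
    unfolding Ad_def inv unfolding D(1) \<eta> by (auto simp: block_mult)
  then show ?thesis by (auto simp: skew_conj[OF D(2)] se23_eq)
qed

lemma TG_simps [simp]:
  "carrier TG = SE23 \<times> se23"
  "\<one>\<^bsub>TG\<^esub> = (mat 1, 0)"
  "X \<otimes>\<^bsub>TG\<^esub> Y = (fst X ** fst Y, snd X + Ad (fst X) (snd Y))"
  by (simp_all add: TG_def)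

lemma group_TG: "group TG"
proof (rule groupI)
  fix X Y assume "X \<in> carrier TG" "Y \<in> carrier TG"
  then show "X \<otimes>\<^bsub>TG\<^esub> Y \<in> carrier TG"
    by (auto simp: SE23_mult Ad_se23 subspace_add[OF subspace_se23])
next
  show "\<one>\<^bsub>TG\<^esub> \<in> carrier TG"
    by (simp add: SE23_one subspace_0[OF subspace_se23])
next
  fix X Y Z assume "X \<in> carrier TG" "Y \<in> carrier TG" "Z \<in> carrier TG"
  then show "X \<otimes>\<^bsub>TG\<^esub> Y \<otimes>\<^bsub>TG\<^esub> Z = X \<otimes>\<^bsub>TG\<^esub> (Y \<otimes>\<^bsub>TG\<^esub> Z)"
    by (auto simp: matrix_mul_assoc Ad_mult Ad_linear)
next
  fix X assume "X \<in> carrier TG"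
  then show "\<one>\<^bsub>TG\<^esub> \<otimes>\<^bsub>TG\<^esub> X = X" by (auto simp: Ad_one)
next
  fix X assume X: "X \<in> carrier TG"
  let ?Y = "(matrix_inv (fst X), - Ad (matrix_inv (fst X)) (snd X))"
  have "?Y \<in> carrier TG" using X by (auto simp: SE23_inv Ad_se23 subspace_neg[OF subspace_se23])
  moreover have "?Y \<otimes>\<^bsub>TG\<^esub> X = \<one>\<^bsub>TG\<^esub>" using X by (auto simp: SE23_inv)
  ultimately show "\<exists>Y\<in>carrier TG. Y \<otimes>\<^bsub>TG\<^esub> X = \<one>\<^bsub>TG\<^esub>" by blast
qed

lemma TG_inv:
  assumes "D \<in> SE23" "\<delta> \<in> se23"
  shows "inv\<^bsub>TG\<^esub> (D, \<delta>) = (matrix_inv D, - Ad (matrix_inv D) \<delta>)"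
proof (rule group.inv_equality[OF group_TG])
  show "(matrix_inv D, - Ad (matrix_inv D) \<delta>) \<otimes>\<^bsub>TG\<^esub> (D, \<delta>) = \<one>\<^bsub>TG\<^esub>"
    using assms by (simp add: SE23_inv)
qed (use assms in \<open>auto simp: SE23_inv Ad_se23 subspace_neg[OF subspace_se23]\<close>)

lemma wedge_in [simp]: "wedge u \<in> se23"
  by (simp add: se23_def)

lemma wedge_Ad_vee: "D \<in> SE23 \<Longrightarrow> wedge (Ad_vee D u) = Ad D (wedge u)"
  by (simp add: Ad_vee_def wedge_vee Ad_se23)

lemma wedge_eqI: "wedge u = wedge v \<Longrightarrow> u = v"
  using wedge_inj by (simp add: inj_eq)

lemma Omega_in:
  assumes "Z \<in> SE23" shows "Omega Z \<in> se23"
proof -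
  obtain A a b where Z: "Z = block A a b 1" using assms by (auto simp: SE23_def)
  have "Omega Z = block (skew 0) 0 a 0"
    by (simp add: Z Omega_def mat5_simps Nmat_def skew_entries if_distrib cong: if_cong)
  then show ?thesis by (auto simp: se23_eq)
qed

lemmas wedge_linear = linear_add[OF linear_wedge] linear_diff[OF linear_wedge]

lemma phi_action:
  "phi \<one>\<^bsub>TG\<^esub> \<xi> = \<xi>"
  "X \<in> carrier TG \<Longrightarrow> \<xi> \<in> state_space \<Longrightarrow> phi X \<xi> \<in> state_space"
  "X \<in> carrier TG \<Longrightarrow> Y \<in> carrier TG \<Longrightarrow> phi (X \<otimes>\<^bsub>TG\<^esub> Y) \<xi> = phi Y (phi X \<xi>)"
proof -
  have "vee 0 = 0" using vee_wedge[of 0] by (simp add: linear_0[OF linear_wedge])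
  then show "phi \<one>\<^bsub>TG\<^esub> \<xi> = \<xi>"
    by (simp add: phi_def matrix_inv_one Ad_vee_def Ad_one split: prod.split)
  show "X \<in> carrier TG \<Longrightarrow> \<xi> \<in> state_space \<Longrightarrow> phi X \<xi> \<in> state_space"
    by (auto simp: phi_def state_space_def SE23_mult)
  show "phi (X \<otimes>\<^bsub>TG\<^esub> Y) \<xi> = phi Y (phi X \<xi>)" if "X \<in> carrier TG" "Y \<in> carrier TG"
    using that
    by (auto simp: phi_def matrix_mul_assoc split: prod.split intro!: wedge_eqI)
      (simp add: wedge_Ad_vee SE23_inv SE23_mult wedge_linear wedge_vee Ad_se23 matrix_inv_mult
        subspace_add[OF subspace_se23] Ad_mult Ad_linear Ad_Ad_inv)
qed

lemma psi_action:
  "psi \<one>\<^bsub>TG\<^esub> u = u"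
  "X \<in> carrier TG \<Longrightarrow> Y \<in> carrier TG \<Longrightarrow> psi (X \<otimes>\<^bsub>TG\<^esub> Y) u = psi Y (psi X u)"
proof -
  have "vee 0 = 0" using vee_wedge[of 0] by (simp add: linear_0[OF linear_wedge])
  then show "psi \<one>\<^bsub>TG\<^esub> u = u"
    by (simp add: psi_def matrix_inv_one Ad_vee_def Ad_one Omega_def split: prod.split)
  have Om: "Omega (matrix_inv E ** matrix_inv D) =
      Ad (matrix_inv E) (Omega (matrix_inv D)) + Omega (matrix_inv E)"
    if D: "D \<in> SE23" and E: "E \<in> SE23" for D E
  proof -
    have N: "Nmat ** Z = Nmat" if "Z \<in> SE23" for Z
      using that by (auto simp: SE23_def mat5_simps Nmat_def if_distrib cong: if_cong)
    have Om: "Omega Z = Z ** Nmat - Nmat" if "Z \<in> SE23" for Z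
      using that by (simp add: Omega_def N)
    have sub: "P ** (Q - R) = P ** Q - P ** R" "(Q - R) ** P = Q ** P - R ** P"
      for P Q R :: "mat5"
      by (simp_all add: matrix_matrix_mult_def vec_eq_iff sum_subtractf algebra_simps)
    have "Ad (matrix_inv E) (Omega (matrix_inv D)) =
        matrix_inv E ** matrix_inv D ** (Nmat ** E) - matrix_inv E ** (Nmat ** E)"
      by (simp add: Om SE23_inv D E Ad_def sub matrix_mul_assoc)
    then show ?thesis by (simp add: N D E Om SE23_inv SE23_mult)
  qed
  show "psi (X \<otimes>\<^bsub>TG\<^esub> Y) u = psi Y (psi X u)" if "X \<in> carrier TG" "Y \<in> carrier TG"
    using that
    by (auto simp: psi_def matrix_mul_assoc split: prod.split intro!: wedge_eqI)
      (simp_all add: wedge_Ad_vee SE23_inv SE23_mult wedge_linear wedge_vee Ad_se23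
        subspace_add[OF subspace_se23] Ad_mult Ad_linear Ad_Ad_inv matrix_inv_mult Omega_in Om)
qed

end

(* Equivariance is a computation in which N D = N turns Omega(D^-1) into Ad_{D^-1} N - N, so that the
   N-terms of Lambda_1 transform by the adjoint map as well.  For the lift property, the orbit map
   extends to a polynomial near the identity, and the product rule gives its value on the Lie algebra.
   The value does not depend on the derivative chosen, because every Lie algebra element is the
   velocity of a curve in the group. *)
theory Submission
  imports Defs
begin

section \<open>Matrix products and commutators on the group and its Lie algebra\<close>

lemma bounded_bilinear_matrix_mult:
  "bounded_bilinear ((**) :: real^'n^'m \<Rightarrow> real^'k^'n \<Rightarrow> real^'k^'m)"
  unfolding bilinear_conv_bounded_bilinear[symmetric] bilinear_def
  by (auto intro!: linearI simp: matrix_matrix_mult_def vec_eq_iff sum.distrib sum_distrib_left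
      algebra_simps)

lemmas has_derivative_matrix_mult = bounded_bilinear.FDERIV[OF bounded_bilinear_matrix_mult]

lemmas matrix_mult_bilinear =
  bounded_bilinear.add_left[OF bounded_bilinear_matrix_mult]
  bounded_bilinear.add_right[OF bounded_bilinear_matrix_mult]
  bounded_bilinear.diff_left[OF bounded_bilinear_matrix_mult]
  bounded_bilinear.diff_right[OF bounded_bilinear_matrix_mult]
  bounded_bilinear.minus_left[OF bounded_bilinear_matrix_mult]
  bounded_bilinear.minus_right[OF bounded_bilinear_matrix_mult]

text \<open>Left multiplication by \<open>Nmat\<close> moves the fifth row of \<open>Z\<close> into
  row 4, and that fifth row is the same for all group elements.\<close>

lemma Nmat_mult_SE23: "Z \<in> SE23 \<Longrightarrow> Nmat ** Z = Nmat"
  by (auto simp: SE23_def mat5_simps Nmat_def if_distrib cong: if_cong)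

lemma Ad_ad: "D \<in> SE23 \<Longrightarrow> Ad D (ad \<eta> \<kappa>) = ad (Ad D \<eta>) (Ad D \<kappa>)"
proof -
  assume D: "D \<in> SE23"
  have "Ad D x ** Ad D y = Ad D (x ** y)" for x y
  proof -
    have "Ad D x ** Ad D y = D ** x ** (matrix_inv D ** D) ** y ** matrix_inv D"
      by (simp only: Ad_def matrix_mul_assoc)
    then show ?thesis by (simp add: SE23_inv D Ad_def matrix_mul_assoc)
  qed
  then show ?thesis by (simp add: ad_def Ad_linear)
qed

lemma ad_diff_left: "ad (x - y) z = ad x z - ad y z"
  and ad_minus_left: "ad (- x) z = - ad x z"
  by (simp_all add: ad_def matrix_mult_bilinear)

lemma ad_se23:
  assumes "\<eta> \<in> se23" "\<kappa> \<in> se23"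
  shows "ad \<eta> \<kappa> \<in> se23"
proof -
  obtain \<omega> v p where \<eta>: "\<eta> = block (skew \<omega>) v p 0" using assms by (auto simp: se23_eq)
  obtain \<omega>' v' p' where \<kappa>: "\<kappa> = block (skew \<omega>') v' p' 0" using assms by (auto simp: se23_eq)
  \<comment> \<open>The rotational part is the bracket of so(3), which is the cross product under
    \<open>skew\<close>.\<close>
  have "ad \<eta> \<kappa> = block (skew (cross3 \<omega> \<omega>')) (skew \<omega> *v v' - skew \<omega>' *v v)
      (skew \<omega> *v p' - skew \<omega>' *v p) 0"
    by (simp add: \<eta> \<kappa> ad_def mat5_simps skew_entries cross3_def algebra_simps)
  then show ?thesis by (auto simp: se23_eq)
qed

section \<open>Membership in the Lie algebra and equivariance\<close>

text \<open>\<open>Nmat\<close> itself lies outside \<open>se23\<close> because of its entry in row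
  4. Conjugating the other \<open>Nmat\<close> by \<open>T\<close> leaves
  \<open>matrix_inv T ** Nmat\<close>, and the difference of the two is
  \<open>- Omega (matrix_inv T)\<close>, which is in \<open>se23\<close>.\<close>

lemma Lambda1_in: "\<xi> \<in> state_space \<Longrightarrow> Lambda1 g \<xi> u \<in> se23"
proof -
  assume "\<xi> \<in> state_space"
  then obtain T b where \<xi>: "\<xi> = (T, b)" and T: "T \<in> SE23" by (auto simp: state_space_def)
  obtain w \<tau> where u: "u = (w, \<tau>)" by (cases u)
  obtain A a c where A: "T = block A a c 1" "rotation_matrix A" using T by (auto simp: SE23_def)
  have "Gmat g ** T = Gmat g" by (simp add: A Gmat_def block_mult)
  then have "Lambda1 g \<xi> u = wedge w - wedge b + (matrix_inv T ** Gmat g - Omega (matrix_inv T))"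
    using Nmat_mult_SE23[OF T] Nmat_mult_SE23[OF SE23_inv(1)[OF T]]
    by (simp add: \<xi> u Lambda1_def Omega_def matrix_mult_bilinear flip: matrix_mul_assoc)
  \<comment> \<open>Only the velocity column survives; it holds gravity rotated into the body
    frame.\<close>
  moreover have "matrix_inv T ** Gmat g = block (skew 0) (transpose A *v g) 0 0"
    by (simp add: A SE23_inv_block Gmat_def block_mult skew_def cross3_def)
      (simp add: mat5_simps matrix_def cross3_def)
  then have "matrix_inv T ** Gmat g \<in> se23" by (auto simp: se23_eq)
  ultimately show ?thesis
    by (simp add: T SE23_inv Omega_in subspace_add[OF subspace_se23] subspace_diff[OF subspace_se23])
qed

lemma Lambda_in: "\<xi> \<in> state_space \<Longrightarrow> Lambda g \<xi> u \<in> TG_alg"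
  using Lambda1_in[of \<xi> g u]
  by (auto simp: Lambda_def TG_alg_def Lambda2_def split: prod.splits
      intro!: subspace_diff[OF subspace_se23] ad_se23)

lemma Lambda_equivariant:
  assumes X: "X \<in> carrier TG" and \<xi>: "\<xi> \<in> state_space"
  shows "TG_Ad (inv\<^bsub>TG\<^esub> X) (Lambda g \<xi> u) = Lambda g (phi X \<xi>) (psi X u)"
proof -
  obtain D \<delta> where X_eq: "X = (D, \<delta>)" and D: "D \<in> SE23" and \<delta>: "\<delta> \<in> se23" using X by auto
  obtain T b where \<xi>_eq: "\<xi> = (T, b)" and T: "T \<in> SE23" using \<xi> by (auto simp: state_space_def)
  obtain w \<tau> where u: "u = (w, \<tau>)" by (cases u)
  let ?E = "matrix_inv D"
  note E = SE23_inv[OF D]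
  have N: "Ad ?E Nmat = ?E ** Nmat"
    by (simp add: Ad_def E Nmat_mult_SE23[OF D] flip: matrix_mul_assoc)
  have Om: "wedge (vee (Omega ?E)) = Ad ?E Nmat - Nmat"
    unfolding wedge_vee[OF Omega_in[OF E(1)]]
    by (simp add: Omega_def N Nmat_mult_SE23[OF E(1)])
  have conj: "matrix_inv (T ** D) ** (Gmat g - Nmat) ** (T ** D)
      = Ad ?E (matrix_inv T ** (Gmat g - Nmat) ** T)"
    by (simp add: matrix_inv_mult T D Ad_def E matrix_mul_assoc)
  have 1: "Lambda1 g (phi X \<xi>) (psi X u) = Ad ?E (Lambda1 g \<xi> u)"
    by (simp add: X_eq \<xi>_eq u Lambda1_def phi_def psi_def conj wedge_linear wedge_Ad_vee E
        wedge_vee \<delta> Om Ad_linear)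
  \<comment> \<open>The shift of the bias by \<open>\<delta>\<close> inside \<open>ad\<close>
    matches the term that \<open>TG_Ad\<close> contributes through the second component of the group
    inverse.\<close>
  have 2: "Lambda2 g (phi X \<xi>) (psi X u)
      = ad (Ad ?E (wedge b) - Ad ?E \<delta>) (Ad ?E (Lambda1 g \<xi> u)) - Ad ?E (wedge \<tau>)"
    using 1 by (simp add: X_eq \<xi>_eq u Lambda2_def phi_def psi_def wedge_linear wedge_Ad_vee E
        wedge_vee \<delta> Ad_linear)
  show ?thesis
    unfolding Lambda_def 1 2
    by (simp add: X_eq \<xi>_eq u TG_inv D \<delta> TG_Ad_def Lambda2_def Ad_linear Ad_ad E ad_diff_left
        ad_minus_left)
qed

text \<open>Although \<open>matrix_inv\<close> is rational in general, on \<open>SE\<^sub>2(3)\<close> it agrees with a quadratic polynomial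
  in the entries, whose differential at the identity is read off from the product rule.\<close>

lemma matrix_inv_has_derivative_SE23:
  obtains I' where "(matrix_inv has_derivative I') (at (mat 1) within SE23)"
    "\<And>\<eta>. \<eta> \<in> se23 \<Longrightarrow> I' \<eta> = - \<eta>"
proof -
  \<comment> \<open>A group element is a translation times a rotation, so its inverse is the inverse
    rotation \<open>P D + C\<close> times the inverse translation \<open>mat 1 + Q D\<close>, with
    \<open>P\<close> and \<open>Q\<close> linear.\<close>
  define P :: "mat5 \<Rightarrow> mat5" where
    "P D = (\<chi> i j. if i = 4 \<or> i = 5 \<or> j = 4 \<or> j = 5 then 0 else D$j$i)" for D
  define Q :: "mat5 \<Rightarrow> mat5" where
    "Q D = (\<chi> i j. if (j = 4 \<or> j = 5) \<and> i \<noteq> 4 \<and> i \<noteq> 5 then - D$i$j else 0)" for D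
  define C where "C = block 0 0 0 1"
  have lin: "bounded_linear P" "bounded_linear Q"
    by (auto intro!: linear_linear[THEN iffD2] linearI simp: P_def Q_def vec_eq_iff
        simp flip: linear_conv_bounded_linear)
  have inv: "matrix_inv D = (P D + C) ** (mat 1 + Q D)" if "D \<in> SE23" for D
  proof -
    from that obtain A a b where D: "D = block A a b 1" "rotation_matrix A" by (auto simp: SE23_def)
    have "P D + C = block (transpose A) 0 0 1" "mat 1 + Q D = block (mat 1) (- a) (- b) 1"
      by (simp_all add: D P_def Q_def C_def mat5_simps transpose_def mat_def)
    moreover have "B *v (- x) = - (B *v x)" for B :: "real^3^3" and x
      by (simp add: vec_eq_iff matrix_vector_mult_def sum_negf)
    ultimately show ?thesis
      by (simp add: D SE23_inv_block block_mult del: transpose_matrix_vector)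
  qed
  have one: "P (mat 1) + C = mat 1" "mat 1 + Q (mat 1) = mat 1"
    by (simp_all add: P_def Q_def C_def mat5_simps mat_def)
  have dP: "((\<lambda>D. P D + C) has_derivative P) (at (mat 1) within SE23)"
    by (intro has_derivative_add_const bounded_linear_imp_has_derivative lin)
  have dQ: "((\<lambda>D. mat 1 + Q D) has_derivative Q) (at (mat 1) within SE23)"
    using has_derivative_add_const[OF bounded_linear_imp_has_derivative[OF lin(2)]]
    by (simp add: add.commute)
  have "((\<lambda>D. (P D + C) ** (mat 1 + Q D)) has_derivative (\<lambda>H. Q H + P H)) (at (mat 1) within SE23)"
    using has_derivative_matrix_mult[OF dP dQ] by (simp add: one)
  then have "(matrix_inv has_derivative (\<lambda>H. Q H + P H)) (at (mat 1) within SE23)"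
    by (rule has_derivative_transform[OF SE23_one, rotated]) (rule inv)
  \<comment> \<open>\<open>P\<close> transposes the rotational block, which negates it when it is
    skew; \<open>Q\<close> negates the two columns.\<close>
  moreover have "Q \<eta> + P \<eta> = - \<eta>" if "\<eta> \<in> se23" for \<eta>
  proof -
    from that obtain \<omega> v p where \<eta>: "\<eta> = block (skew \<omega>) v p 0" by (auto simp: se23_eq)
    show ?thesis by (simp add: \<eta> P_def Q_def mat5_simps skew_entries)
  qed
  ultimately show ?thesis using that by blast
qed

text \<open>Differentiating the conjugation of \<open>wedge b\<close> gives the commutator, and the
  shift by \<open>\<delta>\<close> gives \<open>- \<zeta>\<close>. The value is given on the Lie
  algebra only, where \<open>I'\<close> is known to be negation.\<close>

lemma phi_has_derivative:
  obtains F' where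
    "((\<lambda>X. phi X (T, b)) has_derivative F') (at (mat 1, 0) within SE23 \<times> se23)"
    "\<And>\<gamma> \<zeta>. \<gamma> \<in> se23 \<Longrightarrow> \<zeta> \<in> se23 \<Longrightarrow> F' (\<gamma>, \<zeta>) = (T ** \<gamma>, vee (ad (wedge b) \<gamma> - \<zeta>))"
proof -
  \<comment> \<open>\<open>vee\<close> is an arbitrary choice outside \<open>se23\<close>; a linear
    left inverse of \<open>wedge\<close> agrees with it on \<open>se23\<close> and can be
    differentiated on the whole space.\<close>
  obtain L where L: "linear L" "L \<circ> wedge = id"
    using linear_injective_left_inverse[OF linear_wedge wedge_inj] by blast
  then have L_wedge: "L (wedge x) = x" for x by (simp add: fun_eq_iff)
  have L_vee: "L \<eta> = vee \<eta>" if "\<eta> \<in> se23" for \<eta>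
    using L_wedge[of "vee \<eta>"] by (simp add: wedge_vee that)
  obtain I' where I': "(matrix_inv has_derivative I') (at (mat 1) within SE23)"
    "\<And>\<eta>. \<eta> \<in> se23 \<Longrightarrow> I' \<eta> = - \<eta>"
    using matrix_inv_has_derivative_SE23 by blast
  let ?S = "SE23 \<times> se23" and ?x = "(mat 1, 0) :: mat5 \<times> mat5"
  let ?B = "wedge b"
  have x: "?x \<in> ?S" by (simp add: SE23_one subspace_0[OF subspace_se23])
  have eq: "phi X (T, b) = (T ** fst X, L (matrix_inv (fst X) ** (?B - snd X) ** fst X))"
    if "X \<in> ?S" for X
  proof -
    from that obtain D \<delta> where X: "X = (D, \<delta>)" and D: "D \<in> SE23" and \<delta>: "\<delta> \<in> se23" by auto
    have "Ad (matrix_inv D) (?B - \<delta>) \<in> se23"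
      by (intro Ad_se23 SE23_inv D subspace_diff[OF subspace_se23] wedge_in \<delta>)
    from L_vee[OF this] show ?thesis
      by (simp add: X phi_def Ad_vee_def wedge_linear wedge_vee \<delta>) (simp add: Ad_def SE23_inv D)
  qed
  have d1: "(fst has_derivative fst) (at ?x within ?S)"
    and d2: "((\<lambda>X. ?B - snd X) has_derivative (\<lambda>H. - snd H)) (at ?x within ?S)"
    by (auto intro!: derivative_eq_intros)
  have "fst ` ?S \<subseteq> SE23" by auto
  then have d3: "((\<lambda>X. matrix_inv (fst X)) has_derivative (\<lambda>H. I' (fst H))) (at ?x within ?S)"
    by (intro has_derivative_in_compose[OF d1])
      (simp add: has_derivative_subset[OF I'(1)] del: fst_image_times)
  have d4: "((\<lambda>X. matrix_inv (fst X) ** (?B - snd X) ** fst X) has_derivative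
      (\<lambda>H. ?B ** fst H + (- snd H + I' (fst H) ** ?B))) (at ?x within ?S)"
    using has_derivative_matrix_mult[OF has_derivative_matrix_mult[OF d3 d2] d1]
    by (simp add: matrix_inv_one)
  have d5: "((\<lambda>X. T ** fst X) has_derivative (\<lambda>H. T ** fst H)) (at ?x within ?S)"
    by (rule bounded_linear.has_derivative[OF
          bounded_bilinear.bounded_linear_right[OF bounded_bilinear_matrix_mult] d1])
  let ?F = "\<lambda>H. (T ** fst H, L (?B ** fst H + (- snd H + I' (fst H) ** ?B)))"
  have "((\<lambda>X. phi X (T, b)) has_derivative ?F) (at ?x within ?S)"
    using L(1)
    by (intro has_derivative_transform[OF x eq] has_derivative_Pair d5
        bounded_linear.has_derivative[OF _ d4]) (simp_all add: linear_conv_bounded_linear)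
  moreover have "?F (\<gamma>, \<zeta>) = (T ** \<gamma>, vee (ad ?B \<gamma> - \<zeta>))" if "\<gamma> \<in> se23" "\<zeta> \<in> se23" for \<gamma> \<zeta>
  proof -
    have "?B ** \<gamma> + (- \<zeta> + I' \<gamma> ** ?B) = ad ?B \<gamma> - \<zeta>"
      by (simp add: I'(2) that ad_def matrix_mult_bilinear)
    moreover have "ad ?B \<gamma> - \<zeta> \<in> se23"
      by (intro subspace_diff[OF subspace_se23] ad_se23 wedge_in that)
    ultimately show ?thesis by (simp only: L_vee fst_conv snd_conv)
  qed
  ultimately show ?thesis using that by blast
qed

text \<open>The Cayley transform of \<open>skew r\<close>, i.e. the rotation with Rodrigues vector \<open>r\<close>: being rational in
  \<open>r\<close>, it gives curves in \<open>SO(3)\<close> with prescribed velocity without the matrix exponential.\<close>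

definition cayley :: "real^3 \<Rightarrow> real^3^3" where
  "cayley r = (1 / (1 + r \<bullet> r)) *\<^sub>R
     ((1 - r \<bullet> r) *\<^sub>R mat 1 + 2 *\<^sub>R (\<chi> i j. r$i * r$j) + 2 *\<^sub>R skew r)"

text \<open>Clearing the denominator \<open>s\<close> leaves polynomial identities for
  \<open>Q\<close>, the Euler-Rodrigues matrix of the quaternion with real part 1 and vector part
  \<open>r\<close>, whose squared norm is \<open>s\<close>.\<close>

lemma rotation_matrix_cayley: "rotation_matrix (cayley r)"
proof -
  define x y z where xyz: "x = r$1" "y = r$2" "z = r$3"
  define Q :: "real^3^3" where
    "Q = (1 - r \<bullet> r) *\<^sub>R mat 1 + 2 *\<^sub>R (\<chi> i j. r$i * r$j) + 2 *\<^sub>R skew r"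
  define s where "s = 1 + r \<bullet> r"
  have s: "s = 1 + x^2 + y^2 + z^2"
    by (simp add: s_def inner_vec_def sum_3 xyz power2_eq_square)
  have pos: "s > 0" by (simp add: s_def add_pos_nonneg)
  have Q: "Q = vector [vector [1 + x^2 - y^2 - z^2, 2*x*y - 2*z, 2*x*z + 2*y],
      vector [2*x*y + 2*z, 1 + y^2 - x^2 - z^2, 2*y*z - 2*x],
      vector [2*x*z - 2*y, 2*y*z + 2*x, 1 + z^2 - x^2 - y^2]]"
    by (simp add: Q_def vec_eq_iff forall_3 skew_entries mat_def inner_vec_def sum_3 xyz
        power2_eq_square)
  have c: "cayley r = (1/s) *\<^sub>R Q" by (simp add: cayley_def Q_def s_def)
  have "transpose Q ** Q = (s^2) *\<^sub>R mat 1"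
    unfolding Q s
    by (simp add: vec_eq_iff forall_3 sum_3 matrix_matrix_mult_def transpose_def mat_def)
      (intro conjI; algebra)
  moreover have "transpose (cayley r) ** cayley r = (1/s^2) *\<^sub>R (transpose Q ** Q)"
    by (simp add: c vec_eq_iff forall_3 sum_3 matrix_matrix_mult_def transpose_def
        power2_eq_square add_divide_distrib)
  ultimately have "orthogonal_matrix (cayley r)"
    using pos by (simp add: orthogonal_matrix)
  moreover have "det Q = s^3"
    unfolding Q s by (simp add: det_3) algebra
  then have "det (cayley r) = 1"
    using pos unfolding c by (simp add: det_3 power3_eq_cube field_simps)
  ultimately show ?thesis by (simp add: rotation_matrix_def)
qed

lemma se23_tangent_curve:
  assumes "\<gamma> \<in> se23"
  obtains c where "\<And>t::real. c t \<in> SE23" "c 0 = mat 1" "(c has_vector_derivative \<gamma>) (at 0)"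
proof -
  obtain \<omega> v p where \<gamma>: "\<gamma> = block (skew \<omega>) v p 0" using assms by (auto simp: se23_eq)
  define q where "q = \<omega> \<bullet> \<omega> / 4"
  define M :: "real^3^3" where "M = (\<chi> i j. \<omega>$i * \<omega>$j / 2)"
  \<comment> \<open>The linear term of \<open>cayley r\<close> is \<open>2 *\<^sub>R skew r\<close>,
    hence the factor 1/2. Translations are unconstrained, so straight lines suffice for
    them.\<close>
  define c where "c t = block (cayley ((t/2) *\<^sub>R \<omega>)) (t *\<^sub>R v) (t *\<^sub>R p) 1" for t
  define f where "f t = inverse (1 + t^2 * q)" for t
  \<comment> \<open>With constant matrices and scalar coefficients, only the coefficients
    \<open>f t * t\<close> and \<open>t\<close> have nonzero derivative at 0, namely 1.\<close>
  have c_eq: "c t = (f t * (1 - t^2 * q)) *\<^sub>R block (mat 1) 0 0 0 + (f t * t^2) *\<^sub>R block M 0 0 0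
      + (f t * t) *\<^sub>R block (skew \<omega>) 0 0 0 + t *\<^sub>R block 0 v p 0 + block 0 0 0 1" for t
  proof -
    have "((t/2) *\<^sub>R \<omega>) \<bullet> ((t/2) *\<^sub>R \<omega>) = t^2 * q"
      by (simp add: q_def power2_eq_square)
    moreover have "2 *\<^sub>R (\<chi> i j. ((t/2) *\<^sub>R \<omega>)$i * ((t/2) *\<^sub>R \<omega>)$j) = t^2 *\<^sub>R M"
      by (simp add: M_def vec_eq_iff power2_eq_square)
    moreover have "2 *\<^sub>R skew ((t/2) *\<^sub>R \<omega>) = t *\<^sub>R skew \<omega>"
      by (simp add: skew_entries vec_eq_iff forall_3)
    ultimately have cay: "cayley ((t/2) *\<^sub>R \<omega>) =
        (f t * (1 - t^2 * q)) *\<^sub>R mat 1 + (f t * t^2) *\<^sub>R M + (f t * t) *\<^sub>R skew \<omega>"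
      unfolding cayley_def by (simp add: f_def inverse_eq_divide scaleR_add_right mult.commute[of q])
    show ?thesis
      unfolding c_def cay by (simp add: mat5_simps)
  qed
  have f: "(f has_vector_derivative 0) (at 0)"
    unfolding f_def has_real_derivative_iff_has_vector_derivative[symmetric]
    by (auto intro!: derivative_eq_intros)
  have "block (skew \<omega>) 0 0 0 + block 0 v p 0 = \<gamma>" by (simp add: \<gamma> block_add)
  then have "(c has_vector_derivative \<gamma>) (at 0)"
    unfolding c_eq[abs_def] by (auto intro!: derivative_eq_intros f simp: f_def)
  moreover have "c t \<in> SE23" for t
    unfolding c_def SE23_def using rotation_matrix_cayley by blast
  moreover have "c 0 = mat 1"
    by (simp add: c_def cayley_def mat5_simps skew_entries mat_def)
  ultimately show ?thesis using that by auto
qed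

text \<open>By the chain rule both values are the derivative at 0 of \<open>F\<close> along
  \<open>c\<close>, a function on the whole real line, where derivatives are unique.\<close>

lemma has_derivative_within_unique_on_curve:
  fixes c :: "real \<Rightarrow> 'a::real_normed_vector" and F :: "'a \<Rightarrow> 'b::real_normed_vector"
  assumes F: "(F has_derivative F') (at (c 0) within S)" "(F has_derivative F'') (at (c 0) within S)"
    and c: "\<And>t. c t \<in> S" "(c has_vector_derivative v) (at 0)"
  shows "F' v = F'' v"
proof -
  have "((\<lambda>t. F (c t)) has_vector_derivative F' v) (at 0)"
    if "(F has_derivative F') (at (c 0) within S)" for F'
  proof -
    have dc: "(c has_derivative (\<lambda>t. t *\<^sub>R v)) (at 0)"
      using c(2) by (simp add: has_vector_derivative_def)
    have "(F has_derivative F') (at (c 0) within range c)"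
      by (rule has_derivative_subset[OF that]) (use c(1) in blast)
    from has_derivative_in_compose[OF dc this]
    have "((\<lambda>t. F (c t)) has_derivative (\<lambda>t. F' (t *\<^sub>R v))) (at 0)" .
    moreover have "F' (t *\<^sub>R v) = t *\<^sub>R F' v" for t
      by (rule linear_cmul[OF has_derivative_linear[OF that]])
    ultimately show ?thesis by (simp add: has_vector_derivative_def)
  qed
  from this[OF F(1)] this[OF F(2)] show ?thesis
    by (rule vector_derivative_unique_at)
qed

theorem theorem5p5p4:
  fixes g :: "real^3"
  shows "is_equivariant_lift TG TG_alg TG_Ad state_space phi psi (ins g) (Lambda g)"
proof -
  have "differential_eq (carrier TG) (\<lambda>X. phi X \<xi>) \<one>\<^bsub>TG\<^esub> (Lambda g \<xi> u) (ins g \<xi> u)"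
    if \<xi>: "\<xi> \<in> state_space" for \<xi> u
  proof -
    obtain T b where \<xi>_eq: "\<xi> = (T, b)" and T: "T \<in> SE23" using \<xi> by (auto simp: state_space_def)
    obtain w \<tau> where u: "u = (w, \<tau>)" by (cases u)
    obtain F' where F': "((\<lambda>X. phi X (T, b)) has_derivative F') (at (mat 1, 0) within SE23 \<times> se23)"
      "\<And>\<gamma> \<zeta>. \<gamma> \<in> se23 \<Longrightarrow> \<zeta> \<in> se23 \<Longrightarrow> F' (\<gamma>, \<zeta>) = (T ** \<gamma>, vee (ad (wedge b) \<gamma> - \<zeta>))"
      using phi_has_derivative by blast
    have in1: "Lambda1 g \<xi> u \<in> se23" and in2: "Lambda2 g \<xi> u \<in> se23"
      using Lambda_in[OF \<xi>, of g u] by (auto simp: Lambda_def TG_alg_def)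
    have "T ** Lambda1 g \<xi> u = T ** (wedge w - wedge b + Nmat) + (Gmat g - Nmat) ** T"
      by (simp add: Lambda1_def \<xi>_eq u matrix_add_ldistrib matrix_mul_assoc SE23_inv T)
    \<comment> \<open>In the bias component the commutator in \<open>Lambda2\<close> cancels the one
      in the differential, leaving \<open>\<tau>\<close>.\<close>
    then have val: "F' (Lambda g \<xi> u) = ins g \<xi> u"
      by (simp add: Lambda_def F'(2) in1 in2) (simp add: Lambda2_def ins_def \<xi>_eq u)
    obtain c where c: "\<And>t. c t \<in> SE23" "c 0 = mat 1"
      "(c has_vector_derivative Lambda1 g \<xi> u) (at 0)"
      using se23_tangent_curve[OF in1] by blast
    \<comment> \<open>The second factor of the group is a vector space, so a line through 0 serves
      there.\<close>
    let ?c = "\<lambda>t::real. (c t, t *\<^sub>R Lambda2 g \<xi> u)"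
    have "(?c has_vector_derivative Lambda g \<xi> u) (at 0)"
      unfolding Lambda_def
      by (intro has_vector_derivative_Pair c) (auto intro!: derivative_eq_intros)
    moreover have "?c t \<in> SE23 \<times> se23" for t
      using c in2 by (simp add: subspace_scale[OF subspace_se23])
    ultimately have "F'' (Lambda g \<xi> u) = F' (Lambda g \<xi> u)"
      if "((\<lambda>X. phi X (T, b)) has_derivative F'') (at (mat 1, 0) within SE23 \<times> se23)" for F''
      using has_derivative_within_unique_on_curve[of "\<lambda>X. phi X (T, b)" F'' ?c _ F'] that F'(1)
      by (simp add: c(2))
    then show ?thesis
      using F'(1) unfolding differential_eq_def TG_simps val unfolding \<xi>_eq by blast
  qed
  then show ?thesis
    unfolding is_equivariant_lift_def is_lift_def by (intro conjI ballI allI Lambda_in Lambda_equivariant)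
qed

end
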